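(* Let $n\ge2$, $0<\delta<1$, $\sigma\ge0$, and $$\ell=\ln\frac{4n}{\delta},\quad a=\sqrt{2(n-1)\ell},\quad b=2\sigma\sqrt{\frac{\ell}{n}},\quad m_0=\sqrt{2/\pi}.$$ Let $W$ be a random symmetric $n\times n$ matrix with independent (up to symmetry) entries $W_{ij}\sim\mathcal{N}(0,1)$ for $i\ne j$ and $W_{ii}\sim\mathcal{N}(0,2)$, and let $H=I+\frac{\sigma}{\sqrt n}W$. If $b<1$, then with probability at least $1-\delta$ one has $H_{ii}>0$ for all $i$ and $$\frac{\sigma}{\sqrt n}\cdot\frac{\bigl[(n-1)m_0-a\bigr]_+}{1+b}\ \le\ \theta_{\mathrm{opt}}(H)\ \le\ \frac{\sigma}{\sqrt n}\cdot\frac{(n-1)m_0+a}{1-b}.$$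
   Context: $[t]_+=\max\{t,0\}$. For a symmetric matrix $H$ with positive diagonal, $\theta_{\mathrm{opt}}(H)=\min_{w\in\mathbb{R}^n_{>0}}\max_i\frac{\sum_{j\ne i}|H_{ij}|w_j}{H_{ii}w_i}$; equivalently $\theta_{\mathrm{opt}}(H)=\rho(A)$, the spectral radius of $A=D^{-1}|H-D|$ (entrywise absolute value) with $D=\operatorname{diag}(H_{11},\dots,H_{nn})$. *)

theory Defs
  imports "HOL-Probability.Probability"
begin

(* For symmetric H with positive diagonal the infimum is a minimum: choose w, on each
   irreducible diagonal block of diag(H)^-1 |H - diag(H)|, to be the Perron vector of that block. *)
definition theta_opt :: "real ^ 'n ^ 'n \<Rightarrow> real" where
  "theta_opt H = (INF w \<in> {w :: real ^ 'n. \<forall>i. w $ i > 0}.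
     MAX i. (\<Sum>j \<in> UNIV - {i}. \<bar>H $ i $ j\<bar> * w $ j) / (H $ i $ i * w $ i))"

(* The order on the index type serves only to pick one representative of each unordered
   pair of indices. The second argument of normal_density is the standard deviation. *)
definition gaussian_symmetric_matrix ::
    "'a measure \<Rightarrow> ('a \<Rightarrow> real ^ ('n :: {finite, linorder}) ^ ('n :: {finite, linorder})) \<Rightarrow> bool" where
  "gaussian_symmetric_matrix M W \<longleftrightarrow>
     prob_space M \<and>
     (\<forall>\<omega> \<in> space M. transpose (W \<omega>) = W \<omega>) \<and>
     prob_space.indep_vars M (\<lambda>_. borel) (\<lambda>(i, j) \<omega>. W \<omega> $ i $ j) {(i, j). i \<le> j} \<and>
     (\<forall>i j. i \<noteq> j \<longrightarrow> distributed M lborel (\<lambda>\<omega>. W \<omega> $ i $ j) (normal_density 0 1)) \<and>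
     (\<forall>i. distributed M lborel (\<lambda>\<omega>. W \<omega> $ i $ i) (normal_density 0 (sqrt 2)))"

end

theory Submission
  imports Defs
begin

text \<open>
  If the diagonal of \<open>H\<close> is positive, then \<open>theta_opt H\<close> lies between the smallest and the
  largest value of \<open>(\<Sum>j\<noteq>i. \<bar>H\<^sub>i\<^sub>j\<bar>) / H\<^sub>i\<^sub>i\<close>: constant weights give the upper bound, and
  for arbitrary weights the row in which the weight is minimal gives the lower one (\<open>theta_opt_upper\<close>,
  \<open>theta_opt_lower\<close>). So no spectral theory is needed: it suffices that all off-diagonal absolute row
  sums of \<open>W\<close> are within \<open>a\<close> of their mean \<open>(n - 1) m0\<close>, and that all diagonal entries of \<open>H\<close> are
  within \<open>b\<close> of \<open>1\<close>. These are \<open>2n\<close> events, each of which fails with probability at most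
  \<open>2 exp (- l) = \<delta> / (2n)\<close>.

  A row sum consists of \<open>n - 1\<close> independent copies of \<open>\<bar>X\<bar>\<close> with \<open>X\<close> standard normal. Its concentration
  with the sharp sub-Gaussian constant follows from the Chernoff bound once
  \<open>E exp (c (\<bar>X\<bar> - m0)) \<le> exp (c\<^sup>2 / 2)\<close> is known for all real \<open>c\<close>. Completing the square yields
  \<open>E exp (c \<bar>X\<bar>) = 2 exp (c\<^sup>2 / 2) P(X \<ge> - c)\<close>, which reduces this to \<open>2 P(X \<ge> t) \<le> exp (- m0 t)\<close>
  (\<open>gauss_tail_le\<close>), a comparison of the half-normal law with the exponential law whose density has the
  same value at \<open>0\<close>. The trivial bound \<open>P(X \<ge> - c) \<le> 1\<close> in the same formula handles the diagonal.

  The event of the theorem involves an infimum over uncountably many weights. It is measurable because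
  countably many weights suffice (\<open>measurable_theta_opt\<close>).
\<close>

section \<open>The Gaussian tail and the moment generating function of the half-normal law\<close>

definition gauss_tail :: "real \<Rightarrow> real" where
  "gauss_tail t = (LINT x|lborel. indicator {t..} x * std_normal_density x)"

lemma integrable_gauss_tail: "integrable lborel (\<lambda>x. indicator {t..} x * std_normal_density x :: real)"
  using integrable_mult_indicator[of "{t..}" lborel std_normal_density] by simp

lemma gauss_tail_0: "gauss_tail 0 = 1 / 2"
proof -
  have "has_bochner_integral lborel (\<lambda>x. indicator {0..} x *\<^sub>R std_normal_density x) (gauss_tail 0)"
    using integrable_gauss_tail[of 0] by (simp add: has_bochner_integral_iff gauss_tail_def)
  then have "has_bochner_integral lborel std_normal_density (2 * gauss_tail 0)"
    using has_bochner_integral_even_function[of std_normal_density] by (simp add: std_normal_density_def)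
  then show ?thesis
    by (simp add: has_bochner_integral_iff)
qed

lemma has_bochner_integral_exponential_tail:
  fixes c t :: real
  assumes "c > 0"
  shows "has_bochner_integral lborel (\<lambda>x. indicator {t..} x * (c * exp (- c * x))) (exp (- c * t))"
proof (rule has_bochner_integral_nn_integral)
  have "((\<lambda>x. - exp (- c * x)) \<longlongrightarrow> - 0) at_top"
    using assms
    by (intro tendsto_minus filterlim_compose[OF exp_at_bot] filterlim_tendsto_neg_mult_at_bot[of _ "-c"])
       (auto simp: filterlim_ident)
  then have "(\<integral>\<^sup>+x. ennreal (c * exp (- c * x)) * indicator {t..} x \<partial>lborel) = 0 - (- exp (- c * t))"
    using assms by (intro nn_integral_FTC_atLeast) (auto intro!: derivative_eq_intros)
  then show "(\<integral>\<^sup>+x. ennreal (indicator {t..} x * (c * exp (- c * x))) \<partial>lborel) = ennreal (exp (- c * t))"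
    by (simp add: indicator_mult_ennreal mult.commute)
qed (use assms in auto)

lemma std_normal_density_alt: "std_normal_density x = sqrt (2 / pi) * exp (- x\<^sup>2 / 2) / 2"
  by (simp add: std_normal_density_def real_sqrt_divide real_sqrt_mult field_simps)

text \<open>
  Let \<open>d\<close> be the density \<open>m exp (- m x)\<close> minus \<open>m exp (- x\<^sup>2 / 2)\<close>, with \<open>m = sqrt (2 / pi)\<close>. The two
  densities agree at \<open>0\<close> and have the same mass on \<open>{0..}\<close>, so \<open>d\<close> integrates to \<open>0\<close> there. As \<open>d\<close> is
  negative only between \<open>0\<close> and \<open>2 m\<close>, its integral over \<open>{t..}\<close> cannot drop below \<open>0\<close> for any \<open>t\<close>.
\<close>
lemma gauss_tail_le: "2 * gauss_tail t \<le> exp (- sqrt (2 / pi) * t)"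
proof -
  define m where "m = sqrt (2 / pi)"
  define d where "d x = m * exp (- m * x) - m * exp (- x\<^sup>2 / 2)" for x
  define K where "K s = (LINT x|lborel. indicator {s..} x * d x)" for s
  have m: "m > 0" by (simp add: m_def)
  have K: "has_bochner_integral lborel (\<lambda>x. indicator {s..} x * d x) (exp (- m * s) - 2 * gauss_tail s)" for s
  proof -
    have "has_bochner_integral lborel (\<lambda>x. indicator {s..} x * std_normal_density x) (gauss_tail s)"
      using integrable_gauss_tail[of s] by (simp add: has_bochner_integral_iff gauss_tail_def)
    from has_bochner_integral_diff[OF has_bochner_integral_exponential_tail[OF m, of s] has_bochner_integral_mult_right[OF this, of 2]]
    show ?thesis
      by (simp add: std_normal_density_alt d_def algebra_simps flip: m_def)
  qed
  have d_nonneg: "0 \<le> d x" if "x \<le> 0 \<or> 2 * m \<le> x" for x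
  proof -
    have "0 \<le> x * (x - 2 * m)"
      using that m by (auto intro: mult_nonneg_nonneg mult_nonpos_nonpos)
    then have "exp (- x\<^sup>2 / 2) \<le> exp (- m * x)"
      by (simp add: power2_eq_square algebra_simps)
    then show ?thesis using m by (simp add: d_def)
  qed
  have d_nonpos: "d x \<le> 0" if "0 \<le> x" "x \<le> 2 * m" for x
  proof -
    have "x * (x - 2 * m) \<le> 0"
      using that by (auto intro: mult_nonneg_nonpos)
    then have "exp (- m * x) \<le> exp (- x\<^sup>2 / 2)"
      by (simp add: power2_eq_square algebra_simps)
    then show ?thesis using m by (simp add: d_def)
  qed
  have K_eq: "K s = exp (- m * s) - 2 * gauss_tail s" 
    and K_int: "integrable lborel (\<lambda>x. indicator {s..} x * d x)" for s
    using K[of s] by (auto simp: K_def has_bochner_integral_iff)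
  have "K 0 = 0"
    by (simp add: K_eq gauss_tail_0)
  moreover have "K t \<ge> 0" if "t \<ge> 2 * m"
    unfolding K_def using that by (intro integral_nonneg_AE) (auto intro!: d_nonneg split: split_indicator)
  moreover have "K 0 \<le> K t" if "0 \<le> t" "t \<le> 2 * m"
    unfolding K_def
    by (intro integral_mono K_int) (use that in \<open>auto split: split_indicator intro: d_nonpos\<close>)
  moreover have "K 0 \<le> K t" if "t \<le> 0"
    unfolding K_def
    by (intro integral_mono K_int) (use that in \<open>auto split: split_indicator intro: d_nonneg\<close>)
  ultimately have "K t \<ge> 0" by linarith
  then show ?thesis by (simp add: K_eq m_def)
qed

text \<open>By symmetry only \<open>x \<ge> 0\<close> matters, where completing the square turns the integrand into
  \<open>exp (c\<^sup>2 / 2)\<close> times the normal density shifted by \<open>c\<close>.\<close>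
lemma abs_normal_mgf:
  "has_bochner_integral lborel (\<lambda>x. std_normal_density x * exp (c * \<bar>x\<bar>)) (2 * exp (c\<^sup>2 / 2) * gauss_tail (- c))"
proof -
  have "has_bochner_integral lborel (\<lambda>x. indicator {-c..} x * std_normal_density x) (gauss_tail (-c))"
    using integrable_gauss_tail[of "-c"] by (simp add: has_bochner_integral_iff gauss_tail_def)
  then have "has_bochner_integral lborel (\<lambda>x. indicator {-c..} (- c + 1 * x) * std_normal_density (- c + 1 * x)) (gauss_tail (-c))"
    by (subst (asm) lborel_has_bochner_integral_real_affine_iff[of 1 _ _ "- c"]) auto
  from has_bochner_integral_mult_right[OF this, of "exp (c\<^sup>2 / 2)"]
  have *: "has_bochner_integral lborel (\<lambda>x. exp (c\<^sup>2 / 2) * (indicator {-c..} (- c + 1 * x) * std_normal_density (- c + 1 * x))) (exp (c\<^sup>2 / 2) * gauss_tail (-c))" by simp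
  have "exp (c\<^sup>2 / 2) * (indicator {-c..} (- c + 1 * x) * std_normal_density (- c + 1 * x)) = 
     indicator {0..} x *\<^sub>R (std_normal_density x * exp (c * \<bar>x\<bar>))" for x
    by (auto split: split_indicator simp: std_normal_density_def power2_eq_square field_simps simp flip: exp_add)
  with * have "has_bochner_integral lborel (\<lambda>x. indicator {0..} x *\<^sub>R (std_normal_density x * exp (c * \<bar>x\<bar>))) (exp (c\<^sup>2 / 2) * gauss_tail (-c))" by simp
  from has_bochner_integral_even_function[OF this] show ?thesis
    by (simp add: std_normal_density_def mult.assoc)
qed

lemma gauss_tail_le_1: "gauss_tail t \<le> 1"
proof -
  have "gauss_tail t \<le> (LINT x|lborel. std_normal_density x)"
    unfolding gauss_tail_def
    by (intro integral_mono integrable_gauss_tail) (auto split: split_indicator)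
  then show ?thesis by simp
qed

section \<open>Deviation inequalities for normal variables\<close>

context prob_space
begin

lemma nn_integral_exp_abs_normal:
  assumes "distributed M lborel X std_normal_density"
  shows "(\<integral>\<^sup>+\<omega>. ennreal (exp (c * \<bar>X \<omega>\<bar>)) \<partial>M) = ennreal (2 * exp (c\<^sup>2 / 2) * gauss_tail (- c))"
proof -
  have "(\<integral>\<^sup>+\<omega>. ennreal (exp (c * \<bar>X \<omega>\<bar>)) \<partial>M)
      = (\<integral>\<^sup>+x. ennreal (std_normal_density x) * ennreal (exp (c * \<bar>x\<bar>)) \<partial>lborel)"
    by (rule distributed_nn_integral[OF assms, symmetric]) simp
  also have "\<dots> = (\<integral>\<^sup>+x. ennreal (std_normal_density x * exp (c * \<bar>x\<bar>)) \<partial>lborel)"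
    by (simp add: ennreal_mult')
  also have "\<dots> = ennreal (2 * exp (c\<^sup>2 / 2) * gauss_tail (- c))"
    using abs_normal_mgf[of c] by (subst nn_integral_eq_integral) (auto simp: has_bochner_integral_iff)
  finally show ?thesis .
qed

lemma nn_integral_exp_centred_abs_normal_le:
  assumes "distributed M lborel X std_normal_density"
  shows "(\<integral>\<^sup>+\<omega>. ennreal (exp (c * (\<bar>X \<omega>\<bar> - sqrt (2 / pi)))) \<partial>M) \<le> ennreal (exp (c\<^sup>2 / 2))"
proof -
  define m where "m = sqrt (2 / pi)"
  have [measurable]: "X \<in> borel_measurable M"
    using distributed_measurable[OF assms] by simp
  have "(\<integral>\<^sup>+\<omega>. ennreal (exp (c * (\<bar>X \<omega>\<bar> - m))) \<partial>M)
      = (\<integral>\<^sup>+\<omega>. ennreal (exp (- (c * m))) * ennreal (exp (c * \<bar>X \<omega>\<bar>)) \<partial>M)"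
    by (simp add: exp_add[symmetric] algebra_simps flip: ennreal_mult')
  also have "\<dots> = ennreal (exp (- (c * m))) * ennreal (2 * exp (c\<^sup>2 / 2) * gauss_tail (- c))"
    by (simp add: nn_integral_cmult nn_integral_exp_abs_normal[OF assms])
  also have "\<dots> = ennreal (exp (- (c * m)) * exp (c\<^sup>2 / 2) * (2 * gauss_tail (- c)))"
    by (simp add: mult_ac flip: ennreal_mult')
  also have "\<dots> \<le> ennreal (exp (- (c * m)) * exp (c\<^sup>2 / 2) * exp (c * m))"
    using gauss_tail_le[of "- c"]
    by (intro ennreal_leI mult_left_mono) (auto simp: m_def mult.commute)
  also have "\<dots> = ennreal (exp (c\<^sup>2 / 2))"
    by (simp flip: exp_add)
  finally show ?thesis by (simp add: m_def)
qed

lemma prob_abs_normal_ge: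
  assumes X: "distributed M lborel X (normal_density 0 s)" and s: "s > 0" and t: "t > 0"
  shows "prob {\<omega> \<in> space M. t \<le> \<bar>X \<omega>\<bar>} \<le> 2 * exp (- (t / s)\<^sup>2 / 2)"
proof -
  define u where "u = t / s"
  have u: "u > 0" using s t by (simp add: u_def)
  have Y: "distributed M lborel (\<lambda>\<omega>. X \<omega> / s) std_normal_density"
    using X normal_standard_normal_convert[OF s, of X 0] by simp
  have [measurable]: "X \<in> borel_measurable M"
    using distributed_measurable[OF X] by simp
  have "emeasure M {\<omega> \<in> space M. u \<le> \<bar>X \<omega> / s\<bar>}
      \<le> ennreal (exp (- u * u)) * (\<integral>\<^sup>+\<omega>. ennreal (exp (u * \<bar>X \<omega> / s\<bar>)) * indicator (space M) \<omega> \<partial>M)"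
    by (rule Chernoff_ineq_nn_integral_ge[OF u]) auto
  also have "(\<integral>\<^sup>+\<omega>. ennreal (exp (u * \<bar>X \<omega> / s\<bar>)) * indicator (space M) \<omega> \<partial>M)
      = ennreal (2 * exp (u\<^sup>2 / 2) * gauss_tail (- u))"
    by (subst nn_integral_exp_abs_normal[OF Y, symmetric]) (auto intro!: nn_integral_cong)
  also have "ennreal (exp (- u * u)) * \<dots> = ennreal (2 * exp (- u\<^sup>2 / 2) * gauss_tail (- u))"
    by (simp add: power2_eq_square exp_add[symmetric] mult_ac flip: ennreal_mult')
  also have "\<dots> \<le> ennreal (2 * exp (- u\<^sup>2 / 2) * 1)"
    by (intro ennreal_leI mult_left_mono gauss_tail_le_1) auto
  finally have "prob {\<omega> \<in> space M. u \<le> \<bar>X \<omega> / s\<bar>} \<le> 2 * exp (- u\<^sup>2 / 2)"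
    by (simp add: emeasure_eq_measure)
  also have "{\<omega> \<in> space M. u \<le> \<bar>X \<omega> / s\<bar>} = {\<omega> \<in> space M. t \<le> \<bar>X \<omega>\<bar>}"
    using s by (auto simp: u_def field_simps)
  finally show ?thesis by (simp add: u_def)
qed

text \<open>The sign \<open>s\<close> covers the upper and the lower tail at once; this is where the moment bound is needed
  for negative as well as for positive arguments.\<close>
lemma prob_sum_abs_normal_one_sided:
  fixes X :: "'i \<Rightarrow> 'a \<Rightarrow> real"
  assumes J: "finite J" "J \<noteq> {}"
    and indep: "indep_vars (\<lambda>_. borel) X J"
    and distr: "\<And>i. i \<in> J \<Longrightarrow> distributed M lborel (X i) std_normal_density"
    and t: "t > 0" and s: "\<bar>s\<bar> = 1"
  shows "prob {\<omega> \<in> space M. t \<le> s * ((\<Sum>i\<in>J. \<bar>X i \<omega>\<bar>) - real (card J) * sqrt (2 / pi))}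
    \<le> exp (- t\<^sup>2 / (2 * real (card J)))"
proof -
  define N where "N = real (card J)"
  \<comment> \<open>The minimiser of the Chernoff exponent \<open>- r t + N r\<^sup>2 / 2\<close>.\<close>
  define r where "r = t / N"
  define Y where "Y i \<omega> = r * s * (\<bar>X i \<omega>\<bar> - sqrt (2 / pi))" for i \<omega>
  define f where "f \<omega> = s * ((\<Sum>i\<in>J. \<bar>X i \<omega>\<bar>) - N * sqrt (2 / pi))" for \<omega>
  have N: "N > 0" using J by (simp add: N_def card_gt_0_iff)
  have r: "r > 0" using N t by (simp add: r_def)
  have rs: "(r * s)\<^sup>2 = r\<^sup>2"
    using s by (auto simp: abs_if power_mult_distrib split: if_splits)
  have [measurable]: "X i \<in> borel_measurable M" if "i \<in> J" for i
    using distributed_measurable[OF distr[OF that]] by simp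
  have rf: "r * f \<omega> = (\<Sum>i\<in>J. Y i \<omega>)" for \<omega>
    by (simp add: f_def Y_def N_def sum_subtractf sum_distrib_left[symmetric] mult_ac)
  have "emeasure M {\<omega> \<in> space M. t \<le> f \<omega>}
      \<le> ennreal (exp (- r * t)) * (\<integral>\<^sup>+\<omega>. ennreal (exp (r * f \<omega>)) * indicator (space M) \<omega> \<partial>M)"
    by (rule Chernoff_ineq_nn_integral_ge[OF r]) (auto simp: f_def)
  also have "(\<integral>\<^sup>+\<omega>. ennreal (exp (r * f \<omega>)) * indicator (space M) \<omega> \<partial>M)
      = (\<integral>\<^sup>+\<omega>. (\<Prod>i\<in>J. ennreal (exp (Y i \<omega>))) \<partial>M)"
    by (intro nn_integral_cong) (simp add: rf exp_sum J prod_ennreal)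
  also have "\<dots> = (\<Prod>i\<in>J. \<integral>\<^sup>+\<omega>. ennreal (exp (Y i \<omega>)) \<partial>M)"
    unfolding Y_def by (intro indep_vars_nn_integral J indep_vars_compose2[OF indep]) auto
  also have "\<dots> \<le> (\<Prod>i\<in>J. ennreal (exp (r\<^sup>2 / 2)))"
  proof (intro prod_mono_ennreal)
    fix i assume "i \<in> J"
    then show "(\<integral>\<^sup>+\<omega>. ennreal (exp (Y i \<omega>)) \<partial>M) \<le> ennreal (exp (r\<^sup>2 / 2))"
      using nn_integral_exp_centred_abs_normal_le[OF distr, of i "r * s"] by (simp add: Y_def rs)
  qed
  also have "\<dots> = ennreal (exp (N * (r\<^sup>2 / 2)))"
    unfolding N_def by (simp only: exp_of_nat_mult prod_constant ennreal_power exp_ge_zero)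
  also have "ennreal (exp (- r * t)) * \<dots> = ennreal (exp (- t\<^sup>2 / (2 * N)))"
    using N by (simp add: exp_add[symmetric] flip: ennreal_mult')
       (simp add: r_def power2_eq_square field_simps)
  finally have "prob {\<omega> \<in> space M. t \<le> f \<omega>} \<le> exp (- t\<^sup>2 / (2 * N))"
    by (simp add: emeasure_eq_measure mult_left_mono)
  then show ?thesis by (simp add: f_def N_def)
qed

lemma prob_sum_abs_normal_deviation:
  fixes X :: "'i \<Rightarrow> 'a \<Rightarrow> real"
  assumes J: "finite J" "J \<noteq> {}"
    and indep: "indep_vars (\<lambda>_. borel) X J"
    and distr: "\<And>i. i \<in> J \<Longrightarrow> distributed M lborel (X i) std_normal_density"
    and t: "t > 0"
  shows "prob {\<omega> \<in> space M. t \<le> \<bar>(\<Sum>i\<in>J. \<bar>X i \<omega>\<bar>) - real (card J) * sqrt (2 / pi)\<bar>}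
    \<le> 2 * exp (- t\<^sup>2 / (2 * real (card J)))"
proof -
  define A where "A s = {\<omega> \<in> space M. t \<le> s * ((\<Sum>i\<in>J. \<bar>X i \<omega>\<bar>) - real (card J) * sqrt (2 / pi))}" for s
  have [measurable]: "X i \<in> borel_measurable M" if "i \<in> J" for i
    using distributed_measurable[OF distr[OF that]] by simp
  have meas: "A s \<in> events" for s
    unfolding A_def by measurable
  have A: "prob (A s) \<le> exp (- t\<^sup>2 / (2 * real (card J)))" if "\<bar>s\<bar> = 1" for s
    unfolding A_def by (rule prob_sum_abs_normal_one_sided[OF J indep distr t that])
  have "{\<omega> \<in> space M. t \<le> \<bar>(\<Sum>i\<in>J. \<bar>X i \<omega>\<bar>) - real (card J) * sqrt (2 / pi)\<bar>} = A 1 \<union> A (- 1)"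
    by (auto simp: A_def)
  then show ?thesis
    using measure_Un_le[OF meas meas, of 1 "- 1"] A[of 1] A[of "- 1"] by simp
qed

end

section \<open>Row-sum bounds and measurability for the optimal weighting\<close>

definition row_ratio :: "real ^ 'n ^ 'n \<Rightarrow> real ^ 'n \<Rightarrow> 'n \<Rightarrow> real" where
  "row_ratio H w i = (\<Sum>j \<in> UNIV - {i}. \<bar>H $ i $ j\<bar> * w $ j) / (H $ i $ i * w $ i)"

lemma theta_opt_alt:
  "theta_opt H = (INF w \<in> {w. \<forall>i. w $ i > 0}. Max (range (row_ratio H w)))"
  unfolding theta_opt_def row_ratio_def ..

lemma ex_positive_vector: "{w :: real ^ 'n. \<forall>i. w $ i > 0} \<noteq> {}"
  by (auto intro!: exI[of _ "\<chi> i. 1"])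

lemma bdd_below_theta_opt:
  fixes H :: "real ^ 'n ^ 'n"
  assumes "\<And>i. H $ i $ i > 0"
  shows "bdd_below ((\<lambda>w. Max (range (row_ratio H w))) ` {w. \<forall>i. w $ i > 0})"
proof (rule bdd_belowI2)
  fix w :: "real ^ 'n" assume w: "w \<in> {w. \<forall>i. w $ i > 0}"
  have "0 \<le> row_ratio H w undefined"
    using w assms unfolding row_ratio_def
    by (intro divide_nonneg_nonneg sum_nonneg mult_nonneg_nonneg) (auto intro: less_imp_le)
  also have "\<dots> \<le> Max (range (row_ratio H w))" by simp
  finally show "0 \<le> Max (range (row_ratio H w))" .
qed

lemma theta_opt_upper:
  fixes H :: "real ^ 'n ^ 'n"
  assumes pos: "\<And>i. H $ i $ i > 0"
    and row: "\<And>i. (\<Sum>j \<in> UNIV - {i}. \<bar>H $ i $ j\<bar>) \<le> c * H $ i $ i"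
  shows "theta_opt H \<le> c"
proof -
  have "theta_opt H \<le> Max (range (row_ratio H (\<chi> i. 1)))"
    unfolding theta_opt_alt by (rule cINF_lower[OF bdd_below_theta_opt[OF pos]]) auto
  also have "\<dots> \<le> c"
    using pos row by (auto simp: row_ratio_def divide_le_eq)
  finally show ?thesis .
qed

text \<open>In a row \<open>i\<close> where \<open>w\<close> is minimal, all quotients \<open>w\<^sub>j / w\<^sub>i\<close> are at least \<open>1\<close>, so weighting cannot
  push that row ratio below its unweighted value.\<close>
lemma theta_opt_lower:
  fixes H :: "real ^ 'n ^ 'n"
  assumes pos: "\<And>i. H $ i $ i > 0"
    and row: "\<And>i. c * H $ i $ i \<le> (\<Sum>j \<in> UNIV - {i}. \<bar>H $ i $ j\<bar>)"
  shows "c \<le> theta_opt H"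
  unfolding theta_opt_alt
proof (rule cINF_greatest[OF ex_positive_vector])
  fix w :: "real ^ 'n" assume w: "w \<in> {w. \<forall>i. w $ i > 0}"
  obtain i where i: "\<And>j. w $ i \<le> w $ j"
    using ex_min_if_finite[of "range (\<lambda>i. w $ i)"] by (fastforce simp: not_less)
  have "c * H $ i $ i * w $ i \<le> (\<Sum>j \<in> UNIV - {i}. \<bar>H $ i $ j\<bar>) * w $ i"
    using row[of i] w by (intro mult_right_mono) (auto intro: less_imp_le)
  also have "\<dots> \<le> (\<Sum>j \<in> UNIV - {i}. \<bar>H $ i $ j\<bar> * w $ j)"
    unfolding sum_distrib_right by (intro sum_mono mult_left_mono i) auto
  finally have "c \<le> row_ratio H w i"
    using pos w by (simp add: row_ratio_def pos_le_divide_eq mult.assoc)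
  also have "\<dots> \<le> Max (range (row_ratio H w))" by simp
  finally show "c \<le> Max (range (row_ratio H w))" .
qed

text \<open>For a strict bound \<open>c\<close> the admissible weights form an open set, which is nonempty iff it meets the
  dense set \<open>D\<close>. Clearing denominators keeps the condition continuous in \<open>w\<close> on the whole space.\<close>
lemma theta_opt_less_iff:
  fixes H :: "real ^ 'n ^ 'n"
  assumes pos: "\<And>i. H $ i $ i > 0"
    and D: "\<And>S :: (real ^ 'n) set. open S \<Longrightarrow> S \<noteq> {} \<Longrightarrow> \<exists>d\<in>D. d \<in> S"
  shows "theta_opt H < c \<longleftrightarrow>
    (\<exists>w\<in>D. \<forall>i. w $ i > 0 \<and> (\<Sum>j \<in> UNIV - {i}. \<bar>H $ i $ j\<bar> * w $ j) < c * (H $ i $ i * w $ i))"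
proof -
  define S where "S = {w :: real ^ 'n. \<forall>i. w $ i > 0 \<and> (\<Sum>j \<in> UNIV - {i}. \<bar>H $ i $ j\<bar> * w $ j) < c * (H $ i $ i * w $ i)}"
  have "open S"
    unfolding S_def Collect_all_eq
    by (intro open_INT ballI finite open_Collect_conj open_Collect_less continuous_intros)
  have "theta_opt H < c \<longleftrightarrow> (\<exists>w\<in>{w. \<forall>i. w $ i > 0}. Max (range (row_ratio H w)) < c)"
    unfolding theta_opt_alt by (rule cINF_less_iff[OF ex_positive_vector bdd_below_theta_opt[OF pos]])
  also have "\<dots> \<longleftrightarrow> (\<exists>w. w \<in> S)"
    using pos by (auto simp: S_def row_ratio_def divide_less_eq)
  also have "\<dots> \<longleftrightarrow> (\<exists>w\<in>D. w \<in> S)"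
    using D[OF \<open>open S\<close>] by blast
  finally show ?thesis by (simp add: S_def)
qed

text \<open>The conditional is there because clearing denominators, on which the description of
  \<open>theta_opt H < c\<close> by countably many weights rests, preserves the inequalities only for a positive
  diagonal.\<close>
lemma measurable_theta_opt:
  fixes H :: "'a \<Rightarrow> real ^ 'n ^ 'n"
  assumes [measurable]: "\<And>i j. (\<lambda>\<omega>. H \<omega> $ i $ j) \<in> borel_measurable M"
  shows "(\<lambda>\<omega>. if \<forall>i. H \<omega> $ i $ i > 0 then theta_opt (H \<omega>) else 0) \<in> borel_measurable M"
    (is "?F \<in> _")
proof -
  obtain D :: "(real ^ 'n) set" where D: "countable D"
    and dense: "\<And>S. open S \<Longrightarrow> S \<noteq> {} \<Longrightarrow> \<exists>d\<in>D. d \<in> S"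
    using countable_dense_exists by metis
  have "{\<omega> \<in> space M. ?F \<omega> < c} \<in> sets M" for c
  proof -
    have "{\<omega> \<in> space M. ?F \<omega> < c} = {\<omega> \<in> space M.
        if \<forall>i. H \<omega> $ i $ i > 0
        then \<exists>w\<in>D. \<forall>i. w $ i > 0 \<and> (\<Sum>j \<in> UNIV - {i}. \<bar>H \<omega> $ i $ j\<bar> * w $ j) < c * (H \<omega> $ i $ i * w $ i)
        else 0 < c}"
      by (intro Collect_cong conj_cong refl) (simp add: theta_opt_less_iff[OF _ dense])
    also have "\<dots> \<in> sets M"
      using D by measurable
    finally show ?thesis .
  qed
  then show ?thesis
    by (simp add: borel_measurable_iff_less)
qed

section \<open>The bound for Gaussian perturbations of the identity\<close>

theorem theoremF2:
  fixes M :: "'a measure"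
    and W H :: "'a \<Rightarrow> real ^ ('n :: {finite, linorder}) ^ ('n :: {finite, linorder})"
    and n :: nat
    and \<delta> \<sigma> l a b m0 :: real
  assumes "n = CARD('n)" and "n \<ge> 2"
    and "0 < \<delta>" and "\<delta> < 1" and "\<sigma> \<ge> 0"
    and "l = ln (4 * real n / \<delta>)"
    and "a = sqrt (2 * (real n - 1) * l)"
    and "b = 2 * \<sigma> * sqrt (l / real n)"
    and "m0 = sqrt (2 / pi)"
    and "gaussian_symmetric_matrix M W"
    and "\<And>\<omega>. H \<omega> = mat 1 + (\<sigma> / sqrt (real n)) *\<^sub>R W \<omega>"
    and "b < 1"
  shows "measure M {\<omega> \<in> space M.
           (\<forall>i. H \<omega> $ i $ i > 0) \<and>
           \<sigma> / sqrt (real n) * (max ((real n - 1) * m0 - a) 0 / (1 + b)) \<le> theta_opt (H \<omega>) \<and>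
           theta_opt (H \<omega>) \<le> \<sigma> / sqrt (real n) * (((real n - 1) * m0 + a) / (1 - b))}
         \<ge> 1 - \<delta>"
proof -
  define c where "c = \<sigma> / sqrt (real n)"
  define Good where "Good = {\<omega> \<in> space M. (\<forall>i. H \<omega> $ i $ i > 0) \<and>
    c * (max ((real n - 1) * m0 - a) 0 / (1 + b)) \<le> theta_opt (H \<omega>) \<and>
    theta_opt (H \<omega>) \<le> c * (((real n - 1) * m0 + a) / (1 - b))}"
  define R where "R i \<omega> = (\<Sum>j \<in> UNIV - {i}. \<bar>W \<omega> $ i $ j\<bar>)" for i \<omega>
  define A where "A i = {\<omega> \<in> space M. a \<le> \<bar>R i \<omega> - (real n - 1) * m0\<bar>}" for i
  define B where "B i = {\<omega> \<in> space M. 2 * sqrt l \<le> \<bar>W \<omega> $ i $ i\<bar>}" for i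
  interpret prob_space M
    using assms(10) by (simp add: gaussian_symmetric_matrix_def)
  have sym: "W \<omega> $ i $ j = W \<omega> $ j $ i" if "\<omega> \<in> space M" for \<omega> i j
  proof -
    have "transpose (W \<omega>) = W \<omega>"
      using assms(10) that by (simp add: gaussian_symmetric_matrix_def)
    then have "transpose (W \<omega>) $ i $ j = W \<omega> $ i $ j" by simp
    then show ?thesis by (simp add: transpose_def)
  qed
  have indep: "indep_vars (\<lambda>_. borel) (\<lambda>(i, j) \<omega>. W \<omega> $ i $ j) {(i, j). i \<le> j}"
    and off: "\<And>i j. i \<noteq> j \<Longrightarrow> distributed M lborel (\<lambda>\<omega>. W \<omega> $ i $ j) std_normal_density"
    and diag: "\<And>i. distributed M lborel (\<lambda>\<omega>. W \<omega> $ i $ i) (normal_density 0 (sqrt 2))"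
    using assms(10) by (auto simp: gaussian_symmetric_matrix_def)
  have W_meas [measurable]: "(\<lambda>\<omega>. W \<omega> $ i $ j) \<in> borel_measurable M" for i j
    using distributed_measurable[OF off, of i j] distributed_measurable[OF diag, of i]
    by (cases "i = j") auto
  have n: "real n \<ge> 2" using assms(2) by simp
  have exp_l: "exp (- l) = \<delta> / (4 * real n)"
    using assms(3) n by (simp add: assms(6) exp_minus)
  have l: "l > 0"
    unfolding assms(6) using n assms(3,4) by (intro ln_gt_zero) (simp add: less_divide_eq)
  have a: "a > 0" "a\<^sup>2 = 2 * (real n - 1) * l"
    using n l by (simp_all add: assms(7))
  have c: "c \<ge> 0" using assms(5) by (simp add: c_def)
  have b: "b = c * (2 * sqrt l)" "b \<ge> 0"
    using l assms(5) by (simp_all add: assms(8) c_def real_sqrt_divide)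

  have prob_A: "prob (A i) \<le> \<delta> / (2 * real n)" for i
  proof -
    \<comment> \<open>Independence is known for index pairs on or above the diagonal, so the entries of row \<open>i\<close> are
      moved there by symmetry.\<close>
    define e where "e j = (min i j, max i j)" for j
    define J where "J = e ` (UNIV - {i})"
    have inj: "inj_on e (UNIV - {i})"
      by (auto simp: inj_on_def e_def min_def max_def split: if_splits)
    have card_J: "card J = n - 1"
      by (simp add: J_def card_image[OF inj] card_Diff_singleton assms(1))
    have J: "finite J" "J \<noteq> {}"
      using card_J assms(2) by (auto simp: J_def simp del: image_is_empty)
    have card_J': "real (card J) = real n - 1"
      using card_J assms(2) by (simp add: of_nat_diff)
    have R: "R i \<omega> = (\<Sum>p\<in>J. \<bar>(case p of (i, j) \<Rightarrow> \<lambda>\<omega>. W \<omega> $ i $ j) \<omega>\<bar>)" if "\<omega> \<in> space M" for \<omega>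
      unfolding J_def R_def sum.reindex[OF inj]
      by (intro sum.cong) (auto simp: e_def min_def max_def sym[OF that])
    have "A i = {\<omega> \<in> space M. a \<le> \<bar>(\<Sum>p\<in>J. \<bar>(case p of (i, j) \<Rightarrow> \<lambda>\<omega>. W \<omega> $ i $ j) \<omega>\<bar>)
        - real (card J) * sqrt (2 / pi)\<bar>}"
      by (auto simp: A_def R card_J' assms(9))
    also have "prob \<dots> \<le> 2 * exp (- a\<^sup>2 / (2 * real (card J)))"
    proof (rule prob_sum_abs_normal_deviation[OF J _ _ a(1)])
      show "indep_vars (\<lambda>_. borel) (\<lambda>(i, j) \<omega>. W \<omega> $ i $ j) J"
        by (rule indep_vars_subset[OF indep]) (auto simp: J_def e_def min_def max_def)
      show "distributed M lborel (case p of (i, j) \<Rightarrow> \<lambda>\<omega>. W \<omega> $ i $ j) std_normal_density" if "p \<in> J" for p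
        using that by (auto simp: J_def e_def min_def max_def intro!: off split: if_splits)
    qed
    also have "- a\<^sup>2 / (2 * real (card J)) = - l"
      using n by (simp add: a(2) card_J')
    also have "2 * exp (- l) = \<delta> / (2 * real n)"
      by (simp add: exp_l)
    finally show ?thesis .
  qed
  have prob_B: "prob (B i) \<le> \<delta> / (2 * real n)" for i
  proof -
    have "prob (B i) \<le> 2 * exp (- (2 * sqrt l / sqrt 2)\<^sup>2 / 2)"
      unfolding B_def by (rule prob_abs_normal_ge[OF diag]) (use l in auto)
    also have "- (2 * sqrt l / sqrt 2)\<^sup>2 / 2 = - l"
      using l by (simp add: power_divide power_mult_distrib)
    also have "2 * exp (- l) = \<delta> / (2 * real n)"
      by (simp add: exp_l)
    finally show ?thesis .
  qed

  \<comment> \<open>From here on the argument is deterministic, for one fixed outcome.\<close>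
  have good: "\<omega> \<in> Good" if \<omega>: "\<omega> \<in> space M" and nA: "\<And>i. \<omega> \<notin> A i" and nB: "\<And>i. \<omega> \<notin> B i" for \<omega>
  proof -
    have R: "(real n - 1) * m0 - a \<le> R i \<omega>" "R i \<omega> \<le> (real n - 1) * m0 + a" "0 \<le> R i \<omega>" for i
      using nA[of i] \<omega> by (auto simp: A_def R_def abs_le_iff sum_nonneg)
    have H_eq: "H \<omega> $ i $ j = (if i = j then 1 else 0) + c * W \<omega> $ i $ j" for i j
      by (simp add: assms(11) mat_def c_def)
    have H_diag: "1 - b \<le> H \<omega> $ i $ i" "H \<omega> $ i $ i \<le> 1 + b" for i
    proof -
      have "\<bar>c * W \<omega> $ i $ i\<bar> \<le> b"
        using nB[of i] \<omega> c by (auto simp: b(1) B_def abs_mult intro!: mult_left_mono)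
      then show "1 - b \<le> H \<omega> $ i $ i" "H \<omega> $ i $ i \<le> 1 + b"
        by (auto simp: H_eq abs_le_iff)
    qed
    have H_row: "(\<Sum>j \<in> UNIV - {i}. \<bar>H \<omega> $ i $ j\<bar>) = c * R i \<omega>" for i
      using c by (auto simp: H_eq R_def sum_distrib_left abs_mult intro!: sum.cong)
    have pos: "H \<omega> $ i $ i > 0" for i
      using H_diag(1)[of i] assms(12) by linarith
    have "theta_opt (H \<omega>) \<le> c * (((real n - 1) * m0 + a) / (1 - b))"
    proof (rule theta_opt_upper[OF pos])
      fix i
      have "c * R i \<omega> \<le> c * ((real n - 1) * m0 + a)"
        using c R by (intro mult_left_mono)
      also have "\<dots> = c * (((real n - 1) * m0 + a) / (1 - b)) * (1 - b)"
        using assms(12) by simp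
      also have "\<dots> \<le> c * (((real n - 1) * m0 + a) / (1 - b)) * H \<omega> $ i $ i"
        using R(2,3)[of i] c assms(12) H_diag(1)
        by (intro mult_left_mono mult_nonneg_nonneg divide_nonneg_nonneg) auto
      finally show "(\<Sum>j \<in> UNIV - {i}. \<bar>H \<omega> $ i $ j\<bar>)
          \<le> c * (((real n - 1) * m0 + a) / (1 - b)) * H \<omega> $ i $ i"
        by (simp only: H_row)
    qed
    moreover have "c * (max ((real n - 1) * m0 - a) 0 / (1 + b)) \<le> theta_opt (H \<omega>)"
    proof (rule theta_opt_lower[OF pos])
      fix i
      have "c * (max ((real n - 1) * m0 - a) 0 / (1 + b)) * H \<omega> $ i $ i
          \<le> c * (max ((real n - 1) * m0 - a) 0 / (1 + b)) * (1 + b)"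
        using c b(2) H_diag(2) by (intro mult_left_mono mult_nonneg_nonneg divide_nonneg_nonneg) auto
      also have "\<dots> = c * max ((real n - 1) * m0 - a) 0"
        using b(2) by simp
      also have "\<dots> \<le> c * R i \<omega>"
        using c R by (intro mult_left_mono) auto
      finally show "c * (max ((real n - 1) * m0 - a) 0 / (1 + b)) * H \<omega> $ i $ i
          \<le> (\<Sum>j \<in> UNIV - {i}. \<bar>H \<omega> $ i $ j\<bar>)"
        by (simp only: H_row)
    qed
    ultimately show ?thesis
      using pos \<omega> by (simp add: Good_def)
  qed

  have AB_meas: "A i \<in> events" "B i \<in> events" for i
    unfolding A_def B_def R_def by measurable
  have Good_meas: "Good \<in> events"
  proof -
    have H_meas [measurable]: "(\<lambda>\<omega>. H \<omega> $ i $ j) \<in> borel_measurable M" for i j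
      unfolding assms(11) by simp
    note [measurable] = measurable_theta_opt[OF H_meas]
    have "Good = {\<omega> \<in> space M. (\<forall>i. H \<omega> $ i $ i > 0) \<and>
        c * (max ((real n - 1) * m0 - a) 0 / (1 + b))
          \<le> (if \<forall>i. H \<omega> $ i $ i > 0 then theta_opt (H \<omega>) else 0) \<and>
        (if \<forall>i. H \<omega> $ i $ i > 0 then theta_opt (H \<omega>) else 0)
          \<le> c * (((real n - 1) * m0 + a) / (1 - b))}"
      unfolding Good_def by (intro Collect_cong) auto
    also have "\<dots> \<in> events" by measurable
    finally show ?thesis .
  qed
  have "1 - prob Good = prob (space M - Good)"
    using prob_compl[OF Good_meas] by simp
  also have "\<dots> \<le> prob (\<Union>i. A i \<union> B i)"
  proof (rule finite_measure_mono)
    show "space M - Good \<subseteq> (\<Union>i. A i \<union> B i)"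
      using good by blast
  qed (use AB_meas in auto)
  also have "\<dots> \<le> (\<Sum>i\<in>UNIV. prob (A i \<union> B i))"
    using AB_meas by (intro finite_measure_subadditive_finite) auto
  also have "\<dots> \<le> (\<Sum>i\<in>(UNIV :: 'n set). \<delta> / (2 * real n) + \<delta> / (2 * real n))"
    by (intro sum_mono order_trans[OF measure_Un_le[OF AB_meas]] add_mono prob_A prob_B)
  also have "\<dots> = \<delta>"
    using n by (simp flip: assms(1))
  finally show ?thesis
    by (simp add: Good_def c_def)
qed

end
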